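(* For every $n\ge1$, the set $\{(\mathrm{st}_1(\tau),\mathrm{st}_2(\tau)) : \tau\in\mathrm{SPCT}((2^n))\}\subseteq\mathfrak{S}_n\times\mathfrak{S}_n$ is in bijection with the set of labeled binary trees on $n$ nodes with no right ascents. Consequently its cardinality is $(n+1)^{n-1}$.
   Context: $\mathrm{SPCT}((2^n))$ is the set of fillings $\tau$ of the $n\times2$ array ($n$ rows of length 2) with the distinct integers $1,\dots,2n$ such that each row decreases from left to right and (triple condition) whenever $i<r$ and the entries in cells $(i,1),(i,2),(r,2)$ are $a,b,c$, $a\ge c$ implies $b>c$. For $j\in\{1,2\}$, $\mathrm{st}_j(\tau)\in\mathfrak{S}_n$ is the standardization of the word formed by column $j$ read top to bottom, where the standardization of a word $w_1\cdots w_n$ of distinct integers is the unique $\pi\in\mathfrak{S}_n$ with $\pi(i)>\pi(k)$ iff $w_i>w_k$. A labeled binary tree on $n$ nodes is a rooted plane tree in which each node has at most one left child and at most one right child, nodes labeled distinctly by $[n]$. A right ascent is an edge from a node $p$ to its right child $q$ with $\mathrm{label}(p)<\mathrm{label}(q)$. *)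

theory Defs
  imports Complex_Main "HOL-Combinatorics.Permutations" "HOL-Library.Tree"
begin

text \<open>A filling of the \<open>n \<times> 2\<close> array is a function on cells \<open>(row, column)\<close>, rows numbered
  \<open>1, \<dots>, n\<close> from top to bottom; it is \<open>undefined\<close> off the array, so that distinct functions in
  \<open>SPCT2 n\<close> are distinct fillings.\<close>

definition SPCT2 :: "nat \<Rightarrow> (nat \<times> nat \<Rightarrow> nat) set" where
  "SPCT2 n = {\<tau> \<in> extensional ({1..n} \<times> {1..2}).
     bij_betw \<tau> ({1..n} \<times> {1..2}) {1..2 * n} \<and>
     (\<forall>i\<in>{1..n}. \<tau> (i, 1) > \<tau> (i, 2)) \<and>
     (\<forall>i\<in>{1..n}. \<forall>r\<in>{1..n}. i < r \<longrightarrow> \<tau> (i, 1) \<ge> \<tau> (r, 2) \<longrightarrow> \<tau> (i, 2) > \<tau> (r, 2))}"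

text \<open>The word \<open>w\<^sub>1 \<dots> w\<^sub>n\<close> is given as a function of which only the values on \<open>{1..n}\<close> matter.
  Elements of the symmetric group \<open>\<SS>\<^sub>n\<close> are functions \<open>\<pi>\<close> with \<open>\<pi> permutes {1..n}\<close>.\<close>

definition standardization :: "nat \<Rightarrow> (nat \<Rightarrow> nat) \<Rightarrow> nat \<Rightarrow> nat" where
  "standardization n w = (THE \<pi>. \<pi> permutes {1..n} \<and>
     (\<forall>i\<in>{1..n}. \<forall>k\<in>{1..n}. \<pi> i > \<pi> k \<longleftrightarrow> w i > w k))"

lemma ex1_standardization:
  fixes w :: "nat \<Rightarrow> nat"
  assumes "inj_on w {1..n}"
  shows "\<exists>!\<pi>. \<pi> permutes {1..n} \<and> (\<forall>i\<in>{1..n}. \<forall>k\<in>{1..n}. \<pi> i > \<pi> k \<longleftrightarrow> w i > w k)"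
proof (rule ex_ex1I)
  define R where "R i = card ({1..n} \<inter> {k. w k \<le> w i})" for i
  have fin: "finite ({1..n} \<inter> A)" for A by simp
  have less: "R k < R i" if "k \<in> {1..n}" "i \<in> {1..n}" "w k < w i" for i k
    unfolding R_def
  proof (rule psubset_card_mono[OF fin])
    have "i \<in> {1..n} \<inter> {k. w k \<le> w i}" "i \<notin> {1..n} \<inter> {j. w j \<le> w k}" using that by auto
    moreover have "{1..n} \<inter> {j. w j \<le> w k} \<subseteq> {1..n} \<inter> {k. w k \<le> w i}"
      using that by auto
    ultimately show "{1..n} \<inter> {j. w j \<le> w k} \<subset> {1..n} \<inter> {k. w k \<le> w i}" by blast
  qed
  have mono: "R i > R k \<longleftrightarrow> w i > w k" if "i \<in> {1..n}" "k \<in> {1..n}" for i k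
  proof
    assume "R i > R k"
    show "w i > w k"
    proof (rule ccontr)
      assume "\<not> w i > w k"
      hence "R i \<le> R k" unfolding R_def by (intro card_mono fin) auto
      with \<open>R i > R k\<close> show False by simp
    qed
  qed (use less that in blast)
  have inj: "inj_on R {1..n}"
    by (intro inj_onI) (metis assms inj_onD less linorder_neqE_nat order_less_irrefl)
  have "R ` {1..n} \<subseteq> {1..n}"
  proof (intro image_subsetI)
    fix i assume i: "i \<in> {1..n}"
    have "R i \<le> card {1..n}" unfolding R_def by (intro card_mono) auto
    moreover have "R i > 0" unfolding R_def using i fin by (subst card_gt_0_iff) blast
    ultimately show "R i \<in> {1..n}" by simp
  qed
  hence im: "R ` {1..n} = {1..n}"
    using card_image[OF inj] by (intro card_subset_eq) simp_all
  define \<pi> where "\<pi> i = (if i \<in> {1..n} then R i else i)" for i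
  have "bij_betw \<pi> {1..n} {1..n}"
    using inj im by (subst bij_betw_cong[of _ \<pi> R]) (auto simp: \<pi>_def bij_betw_def)
  hence "\<pi> permutes {1..n}" by (intro bij_imp_permutes) (auto simp: \<pi>_def)
  thus "\<exists>\<pi>. \<pi> permutes {1..n} \<and> (\<forall>i\<in>{1..n}. \<forall>k\<in>{1..n}. \<pi> i > \<pi> k \<longleftrightarrow> w i > w k)"
    using mono by (intro exI[of _ \<pi>]) (auto simp: \<pi>_def)
next
  have val: "\<pi> i = card {k\<in>{1..n}. w k \<le> w i}"
    if p: "\<pi> permutes {1..n}" and w: "\<forall>i\<in>{1..n}. \<forall>k\<in>{1..n}. \<pi> i > \<pi> k \<longleftrightarrow> w i > w k"
      and i: "i \<in> {1..n}" for \<pi> i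
  proof -
    have pi: "\<pi> i \<in> {1..n}" using p i by (metis permutes_in_image)
    have "{k\<in>{1..n}. w k \<le> w i} = {k\<in>{1..n}. \<pi> k \<le> \<pi> i}" using w i by (auto simp: not_less[symmetric])
    also have "\<pi> ` \<dots> = {1..\<pi> i}"
    proof (intro equalityI subsetI)
      fix x assume "x \<in> \<pi> ` {k \<in> {1..n}. \<pi> k \<le> \<pi> i}"
      then obtain k where "k \<in> {1..n}" "\<pi> k \<le> \<pi> i" "x = \<pi> k" by auto
      thus "x \<in> {1..\<pi> i}" using permutes_in_image[OF p, of k] by auto
    next
      fix x assume x: "x \<in> {1..\<pi> i}"
      hence "x \<in> \<pi> ` {1..n}" using pi by (subst permutes_image[OF p]) auto
      thus "x \<in> \<pi> ` {k \<in> {1..n}. \<pi> k \<le> \<pi> i}" using x by auto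
    qed
    finally have "card (\<pi> ` {k\<in>{1..n}. w k \<le> w i}) = \<pi> i" by simp
    thus ?thesis using card_image[OF permutes_inj_on[OF p]] by metis
  qed
  fix \<pi> \<sigma>
  assume a: "\<pi> permutes {1..n} \<and> (\<forall>i\<in>{1..n}. \<forall>k\<in>{1..n}. \<pi> i > \<pi> k \<longleftrightarrow> w i > w k)"
    and b: "\<sigma> permutes {1..n} \<and> (\<forall>i\<in>{1..n}. \<forall>k\<in>{1..n}. \<sigma> i > \<sigma> k \<longleftrightarrow> w i > w k)"
  show "\<pi> = \<sigma>"
  proof
    fix i show "\<pi> i = \<sigma> i"
      using val[of \<pi> i] val[of \<sigma> i] a b by (cases "i \<in> {1..n}") (auto simp: permutes_def)
  qed
qed

definition col_st :: "nat \<Rightarrow> nat \<Rightarrow> (nat \<times> nat \<Rightarrow> nat) \<Rightarrow> nat \<Rightarrow> nat" where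
  "col_st n j \<tau> = standardization n (\<lambda>i. \<tau> (i, j))"

definition st_pairs :: "nat \<Rightarrow> ((nat \<Rightarrow> nat) \<times> (nat \<Rightarrow> nat)) set" where
  "st_pairs n = {(col_st n 1 \<tau>, col_st n 2 \<tau>) | \<tau>. \<tau> \<in> SPCT2 n}"

text \<open>\<open>Leaf\<close> is the empty tree, i.e. an absent child; the nodes are the \<open>Node\<close> constructors.\<close>

definition labeled_binary_trees :: "nat \<Rightarrow> nat tree set" where
  "labeled_binary_trees n = {t. size t = n \<and> set_tree t = {1..n} \<and> distinct (inorder t)}"

text \<open>An edge is recorded as its pair (parent label, child label), which determines it because
  labels are distinct.\<close>

fun right_edges :: "'a tree \<Rightarrow> ('a \<times> 'a) set" where
  "right_edges Leaf = {}"
| "right_edges (Node l p r) =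
     (case r of Leaf \<Rightarrow> {} | Node _ q _ \<Rightarrow> {(p, q)}) \<union> right_edges l \<union> right_edges r"

definition right_ascents :: "'a::linorder tree \<Rightarrow> ('a \<times> 'a) set" where
  "right_ascents t = {(p, q) \<in> right_edges t. p < q}"

end

theory Submission
  imports Defs
begin

text \<open>Let \<open>(\<pi>, \<sigma>)\<close> be a candidate for the pair of standardized columns. The triple condition asks that
  the first entry of row \<open>i\<close> be smaller than every second-column entry which exceeds that of row \<open>i\<close>
  and lies below row \<open>i\<close>. Two linearly ordered columns with such cross relations can be merged unless
  two entries of the first column are forced against \<open>\<pi>\<close>; hence the pair occurs iff
  \<open>\<pi> i < \<pi> j\<close> whenever \<open>\<sigma> i < \<sigma> r \<le> \<sigma> j\<close> for some \<open>r > i\<close>. In terms of the words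
  \<open>p = \<sigma>\<inverse>\<close> and \<open>q = \<pi> \<circ> \<sigma>\<inverse>\<close>, an inversion of \<open>q\<close> at positions \<open>u < v\<close> requires \<open>p\<^sub>u\<close> to be the
  largest of \<open>p\<^sub>u, \<dots>, p\<^sub>v\<close>. Cutting at the position of \<open>Max p\<close>, everything to the left of the
  cut has smaller \<open>q\<close>-values than everything else, and the \<open>q\<close>-value at the cut is free among the
  \<open>k + 1\<close> largest ones, where \<open>k\<close> letters lie to the right. So the numbers \<open>f n\<close> of these pairs satisfy
  \<open>f (n + 1) = (\<Sum>k\<le>n. (n choose k) (k + 1) f k f (n - k))\<close>.

  In a tree without right ascents the labels decrease along the right spine, so the tree is determined
  by the set of its spine nodes with their left subtrees. Removing the spine node whose
  left subtree, itself included, contains a given label yields the same recursion, which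
  Abel's binomial identity solves.\<close>

section \<open>Abel's binomial identity\<close>

text \<open>An \<open>n\<close>-th finite difference kills polynomials of degree below
  \<open>n\<close>. In the induction one factor \<open>x + j\<close> is split off; the part with
  \<open>j\<close> is absorbed into the binomial coefficient, leaving such a sum for
  \<open>n - 1\<close>, \<open>x + 1\<close> and degree \<open>d\<close>.\<close>

lemma alternating_binomial_power_sum:
  fixes x :: "'a::comm_ring_1"
  assumes "d < n"
  shows "(\<Sum>j\<le>n. (-1) ^ j * of_nat (n choose j) * (x + of_nat j) ^ d) = 0"
  using assms
proof (induction d arbitrary: n x)
  case 0
  then show ?case using choose_alternating_sum[of n, where 'a='a] by simp
next
  case (Suc d)
  then obtain m where n: "n = Suc m" and m: "d < m" by (cases n) auto
  have "(\<Sum>j\<le>n. (-1) ^ j * of_nat (n choose j) * (x + of_nat j) ^ Suc d)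
      = x * (\<Sum>j\<le>n. (-1) ^ j * of_nat (n choose j) * (x + of_nat j) ^ d)
        + (\<Sum>j\<le>n. (-1) ^ j * of_nat (j * (n choose j)) * (x + of_nat j) ^ d)"
    by (simp add: sum_distrib_left sum.distrib[symmetric] algebra_simps)
  also have "(\<Sum>j\<le>n. (-1) ^ j * of_nat (j * (n choose j)) * (x + of_nat j) ^ d)
      = (\<Sum>j\<le>m. (-1) ^ Suc j * of_nat (Suc j * (n choose Suc j)) * (x + of_nat (Suc j)) ^ d)"
    unfolding n by (subst sum.atMost_Suc_shift) simp
  also have "\<dots> = - of_nat n * (\<Sum>j\<le>m. (-1) ^ j * of_nat (m choose j) * ((x + 1) + of_nat j) ^ d)"
    unfolding n Suc_times_binomial by (simp add: sum_distrib_left algebra_simps sum_negf)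
  finally show ?case using Suc.IH[of m "x+1"] Suc.IH[of n x] m n by simp
qed

text \<open>Both sides are polynomials in \<open>y\<close>. By the induction hypothesis at
  \<open>y + 1\<close> their derivatives agree, so they differ by a constant, which is evaluated at
  the zero of the right-hand side.\<close>

lemma abel_identity_real:
  fixes y :: real
  shows "(\<Sum>j\<le>n. real (n choose j) * real (Suc j) ^ (j - 1) * (y + real (n - j)) ^ (n - j))
    = (y + real n + 1) ^ n"
proof (induction n arbitrary: y)
  case 0
  show ?case by simp
next
  case (Suc m)
  let ?n = "Suc m"
  define H where "H y = (\<Sum>j\<le>?n. real (?n choose j) * real (Suc j) ^ (j - 1) * (y + real (?n - j)) ^ (?n - j))
    - (y + real ?n + 1) ^ ?n" for y
  have pow: "DERIV (\<lambda>y. (y + c) ^ k) y :> real k * (y + c) ^ (k - 1)" for c y :: real and k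
    using DERIV_power[of "\<lambda>y. y + c" 1 y UNIV k] by (simp add: DERIV_add[of _ 1 _ _ _ 0, simplified])
  have "DERIV H y :> 0" for y
  proof -
    have "DERIV H y :> (\<Sum>j\<le>?n. real (?n choose j) * real (Suc j) ^ (j - 1) * (real (?n - j) * (y + real (?n - j)) ^ (?n - j - 1)))
    - real ?n * (y + real ?n + 1) ^ m"
      unfolding H_def using pow[of "real ?n + 1" ?n y]
      by (intro DERIV_diff DERIV_sum DERIV_cmult pow) (simp add: add.assoc)
    also have "(\<Sum>j\<le>?n. real (?n choose j) * real (Suc j) ^ (j - 1) * (real (?n - j) * (y + real (?n - j)) ^ (?n - j - 1)))
      = (\<Sum>j\<le>m. real ((?n - j) * (?n choose j)) * real (Suc j) ^ (j - 1) * (y + real (?n - j)) ^ (m - j))"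
      by simp (intro sum.cong refl; simp)
    also have "\<dots> = (\<Sum>j\<le>m. real ?n * (real (m choose j) * real (Suc j) ^ (j - 1) * ((y + 1) + real (m - j)) ^ (m - j)))"
      unfolding binomial_absorb_comp by (intro sum.cong refl) (simp add: Suc_diff_le algebra_simps)
    also have "\<dots> = real ?n * (y + 1 + real m + 1) ^ m"
      unfolding sum_distrib_left[symmetric] Suc.IH ..
    finally show ?thesis by (simp add: algebra_simps)
  qed
  \<comment> \<open>At this point \<open>y + ?n + 1\<close> is 0, and each base
    \<open>y + (?n - j)\<close> becomes \<open>- (1 + j)\<close>. The two powers in a summand then
    merge into \<open>(1 + j) ^ m\<close>, and an alternating sum of degree \<open>m < ?n\<close>
    remains.\<close>
  hence "H y = H (- real (Suc ?n))" by (intro DERIV_isconst_all) blast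
  also have "\<dots> = (\<Sum>j\<le>?n. (-1) ^ ?n * ((-1) ^ j * real (?n choose j) * (1 + real j) ^ m))"
  proof -
    have "real (?n choose j) * real (Suc j) ^ (j - 1) * (- real (Suc ?n) + real (?n - j)) ^ (?n - j)
       = (-1) ^ ?n * ((-1) ^ j * real (?n choose j) * (1 + real j) ^ m)" if "j \<le> ?n" for j
    proof -
      have "- real (Suc ?n) + real (?n - j) = (-1) * (1 + real j)" using that by (simp add: of_nat_diff)
      then have "(- real (Suc ?n) + real (?n - j)) ^ (?n - j) = (-1) ^ (?n - j) * (1 + real j) ^ (?n - j)"
        by (simp only: power_mult_distrib)
      moreover have "(-1::real) ^ (?n - j) = (-1) ^ ?n * (-1) ^ j"
        using that by (simp add: minus_one_power_iff)
      moreover have "real (Suc j) ^ (j - 1) * (1 + real j) ^ (?n - j) = (1 + real j) ^ m"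
        using that by (cases j) (simp_all add: power_add[symmetric])
      ultimately show ?thesis by (simp only: mult_ac)
    qed
    moreover have "(- real (Suc ?n) + real ?n + 1) ^ ?n = 0" by simp
    ultimately show ?thesis unfolding H_def by (simp only: diff_zero) (rule sum.cong, simp_all only: atMost_iff)
  qed
  also have "\<dots> = 0"
    unfolding sum_distrib_left[symmetric] by (subst alternating_binomial_power_sum) auto
  finally show ?case unfolding H_def by simp
qed

text \<open>This is the case \<open>y = 1\<close>, summed in reverse order through
  \<open>j = n - k\<close>.\<close>

lemma abel_identity_nat:
  "(\<Sum>k\<le>n. (n choose k) * (Suc k ^ k * Suc (n - k) ^ (n - k - 1))) = Suc (Suc n) ^ n"
proof -
  have "real (\<Sum>k\<le>n. (n choose k) * (Suc k ^ k * Suc (n - k) ^ (n - k - 1)))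
    = (\<Sum>j\<le>n. real (n choose j) * real (Suc j) ^ (j - 1) * (1 + real (n - j)) ^ (n - j))"
    unfolding of_nat_sum
    by (subst sum.nat_diff_reindex[symmetric, of _ "Suc n", simplified lessThan_Suc_atMost])
      (intro sum.cong refl; simp add: binomial_symmetric[symmetric])
  also have "\<dots> = real (Suc (Suc n) ^ n)" unfolding abel_identity_real by simp
  finally show ?thesis by (simp only: of_nat_eq_iff)
qed

section \<open>Sums over subsets, grouped by cardinality\<close>

lemma sum_Pow_card:
  assumes "finite A"
  shows "(\<Sum>S\<in>Pow A. g (card S)) = (\<Sum>k\<le>card A. (card A choose k) * g k)"
proof -
  have "(\<Sum>S\<in>Pow A. g (card S)) = (\<Sum>k\<le>card A. \<Sum>S | S \<in> Pow A \<and> card S = k. g (card S))"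
    using assms by (intro sum.group[symmetric]) (auto intro: card_mono)
  also have "\<dots> = (\<Sum>k\<le>card A. (card A choose k) * g k)"
    using n_subsets[OF assms] by (intro sum.cong) auto
  finally show ?thesis .
qed

text \<open>Both enumerations below end in this sum: the first factor counts the structures on
  \<open>S\<close> together with a choice among \<open>Suc (card S)\<close> elements, the second
  those on the complement.\<close>

lemma sum_Pow_abel:
  assumes "finite A"
  shows "(\<Sum>S\<in>Pow A. Suc (card S) ^ card S * Suc (card A - card S) ^ (card A - card S - 1)) = Suc (Suc (card A)) ^ card A"
  using sum_Pow_card[OF assms, of "\<lambda>k. Suc k ^ k * Suc (card A - k) ^ (card A - k - 1)"] abel_identity_nat
  by simp

section \<open>Trees without right ascents\<close>

definition decreasing_trees :: "nat set \<Rightarrow> nat tree set" where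
  "decreasing_trees A = {t. set_tree t = A \<and> distinct (inorder t) \<and> right_ascents t = {}}"

text \<open>The new node, carrying its left subtree, goes above the first label on the right spine
  not exceeding \<open>x\<close>, so a decreasing spine stays decreasing.\<close>

fun spine_insert :: "nat tree \<Rightarrow> nat \<Rightarrow> nat tree \<Rightarrow> nat tree" where
  "spine_insert l x Leaf = Node l x Leaf"
| "spine_insert l x (Node l' y r) =
     (if x < y then Node l' y (spine_insert l x r) else Node l x (Node l' y r))"

text \<open>Undoes \<open>spine_insert\<close>, with \<open>m\<close> telling which spine node to
  remove. The value at \<open>Leaf\<close> is a dummy, reached only if \<open>m\<close> does not
  occur.\<close>

fun spine_extract :: "nat \<Rightarrow> nat tree \<Rightarrow> (nat tree \<times> nat) \<times> nat tree" where
  "spine_extract m Leaf = ((Leaf, m), Leaf)"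
| "spine_extract m (Node l y r) = (if m \<in> insert y (set_tree l) then ((l, y), r)
     else (let (c, r') = spine_extract m r in (c, Node l y r')))"

lemma right_ascents_Leaf: "right_ascents Leaf = {}"
  by (simp add: right_ascents_def)

lemma right_ascents_Node:
  "right_ascents (Node l y r) = {} \<longleftrightarrow> right_ascents l = {} \<and> right_ascents r = {} \<and>
     (case r of Leaf \<Rightarrow> True | Node _ q _ \<Rightarrow> q \<le> y)"
  by (cases r) (fastforce simp: right_ascents_def)+

lemma set_spine_insert: "set_tree (spine_insert l x r) = insert x (set_tree l \<union> set_tree r)"
  by (induction r) auto

lemma distinct_spine_insert:
  "distinct (inorder (spine_insert l x r)) \<longleftrightarrow> distinct (inorder l) \<and> distinct (inorder r) \<and>
     set_tree l \<inter> set_tree r = {} \<and> x \<notin> set_tree l \<and> x \<notin> set_tree r"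
  by (induction r) (auto simp: set_spine_insert)

lemma right_ascents_spine_insert:
  "right_ascents l = {} \<Longrightarrow> right_ascents r = {} \<Longrightarrow> right_ascents (spine_insert l x r) = {}"
proof (induction r)
  case (Node l' y r)
  then show ?case by (cases r) (auto simp: right_ascents_Node right_ascents_Leaf)
qed (simp add: right_ascents_Node right_ascents_Leaf)

text \<open>As \<open>m\<close> is absent from \<open>r\<close>, no spine node above the inserted
  one is mistaken for it.\<close>

lemma spine_extract_insert:
  "m \<in> insert x (set_tree l) \<Longrightarrow> m \<notin> set_tree r \<Longrightarrow> spine_extract m (spine_insert l x r) = ((l, x), r)"
  by (induction r) auto

text \<open>The spine node responsible for \<open>m\<close> is taken out; since labels strictly
  decrease along the spine, reinsertion finds the same place.\<close>

lemma spine_insert_cases: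
  assumes "right_ascents t = {}" "distinct (inorder t)" "m \<in> set_tree t"
  obtains l x r where "t = spine_insert l x r" "m \<in> insert x (set_tree l)"
    "right_ascents l = {}" "right_ascents r = {}"
proof -
  have "\<exists>l x r. t = spine_insert l x r \<and> m \<in> insert x (set_tree l) \<and>
    right_ascents l = {} \<and> right_ascents r = {}"
    using assms
  proof (induction t)
    case (Node l y r)
    show ?case
    proof (cases "m \<in> insert y (set_tree l)")
      case True
      have "Node l y r = spine_insert l y r"
        using Node.prems by (cases r) (auto simp: right_ascents_Node)
      then show ?thesis using True Node.prems(1) unfolding right_ascents_Node by blast
    next
      case False
      then obtain l' x r' where r: "r = spine_insert l' x r'" "m \<in> insert x (set_tree l')"
        "right_ascents l' = {}" "right_ascents r' = {}"
        using Node.IH(2) Node.prems by (auto simp: right_ascents_Node)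
      have "x \<noteq> y" using Node.prems(2) r(1) by (auto simp: set_spine_insert)
      \<comment> \<open>The root of \<open>r\<close> is \<open>x\<close> or the root
        \<open>q\<close> of \<open>r'\<close>; it is at most \<open>y\<close>, and the other of the
        two is at most that root. So \<open>x\<close> is inserted below \<open>y\<close>, and
        hanging \<open>r'\<close> under \<open>y\<close> creates no ascent.\<close>
      moreover have "case r' of Leaf \<Rightarrow> x \<le> y | Node _ q _ \<Rightarrow> x \<le> y \<and> q \<le> y"
        using Node.prems(1) r(1)
        by (cases r') (auto simp: right_ascents_Node split: if_splits)
      ultimately have "Node l y r = spine_insert l' x (Node l y r')" "right_ascents (Node l y r') = {}"
        using r Node.prems(1) by (auto simp: right_ascents_Node split: tree.splits)
      then show ?thesis using r by blast
    qed
  qed simp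
  then show ?thesis using that by blast
qed

lemma decreasing_trees_empty: "decreasing_trees {} = {Leaf}"
  by (auto simp: decreasing_trees_def right_ascents_Leaf)

text \<open>\<open>S\<close> holds the labels other than \<open>m\<close> in the removed piece,
  \<open>r\<close> is what remains. The spine label \<open>x\<close> may differ from
  \<open>m\<close>, which can lie inside \<open>l\<close>; \<open>spine_extract\<close> recovers all
  the data.\<close>

lemma decreasing_trees_split:
  assumes "m \<in> A"
  shows "bij_betw (\<lambda>(S, r, x, l). spine_insert l x r)
    (SIGMA S : Pow (A - {m}). decreasing_trees (A - {m} - S) \<times>
       (SIGMA x : insert m S. decreasing_trees (insert m S - {x})))
    (decreasing_trees A)" (is "bij_betw ?f ?D _")
proof (rule bij_betw_imageI)
  show "inj_on ?f ?D"
  proof (rule inj_on_inverseI[where g = "\<lambda>t. case spine_extract m t of ((l, x), r) \<Rightarrow>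
      (insert x (set_tree l) - {m}, r, x, l)"])
    fix z assume "z \<in> ?D"
    then obtain S r x l where z: "z = (S, r, x, l)" "S \<subseteq> A - {m}" "x \<in> insert m S"
      "r \<in> decreasing_trees (A - {m} - S)" "l \<in> decreasing_trees (insert m S - {x})"
      by auto
    then have "spine_extract m (spine_insert l x r) = ((l, x), r)"
      by (intro spine_extract_insert) (auto simp: decreasing_trees_def)
    with z show "(case spine_extract m (?f z) of ((l, x), r) \<Rightarrow>
      (insert x (set_tree l) - {m}, r, x, l)) = z"
      by (auto simp: decreasing_trees_def)
  qed
  show "?f ` ?D = decreasing_trees A"
  proof (intro equalityI subsetI)
    fix t assume "t \<in> ?f ` ?D"
    then show "t \<in> decreasing_trees A"
      using assms by (auto simp: decreasing_trees_def set_spine_insert distinct_spine_insert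
          right_ascents_spine_insert)
  next
    fix t assume t: "t \<in> decreasing_trees A"
    then obtain l x r where d: "t = spine_insert l x r" "m \<in> insert x (set_tree l)"
      "right_ascents l = {}" "right_ascents r = {}"
      using spine_insert_cases[of t m] assms by (auto simp: decreasing_trees_def)
    have "t = ?f (insert x (set_tree l) - {m}, r, x, l)" using d(1) by simp
    moreover have "(insert x (set_tree l) - {m}, r, x, l) \<in> ?D"
      using t d assms
      by (auto simp: decreasing_trees_def set_spine_insert distinct_spine_insert)
    ultimately show "t \<in> ?f ` ?D" by (rule image_eqI)
  qed
qed

lemma card_decreasing_trees:
  assumes "finite A"
  shows "finite (decreasing_trees A) \<and> card (decreasing_trees A) = Suc (card A) ^ (card A - 1)"
  using assms
proof (induction "card A" arbitrary: A rule: less_induct)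
  case less
  show ?case
  proof (cases "A = {}")
    case True
    then show ?thesis by (simp add: decreasing_trees_empty)
  next
    case False
    then obtain m where m: "m \<in> A" by blast
    define A' where "A' = A - {m}"
    have A': "finite A'" "card A = Suc (card A')" "m \<notin> A'"
      using less.prems card.remove[OF less.prems m] unfolding A'_def by auto
    define R where "R S = (SIGMA x : insert m S. decreasing_trees (insert m S - {x}))" for S
    let ?D = "SIGMA S : Pow A'. decreasing_trees (A' - S) \<times> R S"
    have left: "finite (decreasing_trees (A' - S))"
      "card (decreasing_trees (A' - S)) = Suc (card A' - card S) ^ (card A' - card S - 1)"
      if "S \<subseteq> A'" for S
      using less.hyps[of "A' - S"] that A' finite_subset[of S A']
      by (auto simp: card_Diff_subset)
    have right: "finite (R S)" "card (R S) = Suc (card S) ^ card S"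
      if S: "S \<subseteq> A'" for S
    proof -
      have fin: "finite S" and "m \<notin> S" and le: "card S \<le> card A'"
        using S A' finite_subset card_mono by auto
      then have card: "card (insert m S) = Suc (card S)" by simp
      have *: "finite (decreasing_trees (insert m S - {x})) \<and>
        card (decreasing_trees (insert m S - {x})) = Suc (card S) ^ (card S - 1)"
        if "x \<in> insert m S" for x
        using less.hyps[of "insert m S - {x}"] that fin card le A'(2)
        by (simp add: card_Diff_singleton)
      then show "finite (R S)" using fin unfolding R_def by blast
      \<comment> \<open>There are \<open>Suc (card S)\<close> choices of \<open>x\<close>, which
        raises the exponent by one; \<open>card S = 0\<close> is treated apart because
        \<open>card S - 1\<close> is truncated there.\<close>
      show "card (R S) = Suc (card S) ^ card S"
        unfolding R_def using * fin card by (cases "card S") auto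
    qed
    note split = decreasing_trees_split[OF m, folded A'_def R_def]
    have fin: "finite ?D"
      using left right A'(1) by (intro finite_SigmaI finite_cartesian_product) simp_all
    have "card ?D = (\<Sum>S\<in>Pow A'. card (decreasing_trees (A' - S)) * card (R S))"
      using left right A'(1) by (subst card_SigmaI) (simp_all add: card_cartesian_product)
    also have "\<dots> = (\<Sum>S\<in>Pow A'. Suc (card S) ^ card S * Suc (card A' - card S) ^ (card A' - card S - 1))"
      by (intro sum.cong refl) (simp add: left right)
    also have "\<dots> = Suc (card A) ^ card A'" using sum_Pow_abel[OF A'(1)] A'(2) by simp
    finally have card: "card ?D = Suc (card A) ^ card A'" .
    have "card (decreasing_trees A) = Suc (card A) ^ card A'"
      using card unfolding bij_betw_same_card[OF split] .
    moreover have "finite (decreasing_trees A)"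
      using fin unfolding bij_betw_finite[OF split] .
    ultimately show ?thesis using A'(2) by simp
  qed
qed

section \<open>Compatible pairs of words\<close>

definition lower_part :: "nat \<Rightarrow> 'a::linorder set \<Rightarrow> 'a set" where
  "lower_part k B = set (take k (sorted_list_of_set B))"

lemma lower_part:
  assumes "finite B" "k \<le> card B"
  shows "lower_part k B \<subseteq> B" "card (lower_part k B) = k"
    "\<And>x y. x \<in> lower_part k B \<Longrightarrow> y \<in> B - lower_part k B \<Longrightarrow> x < y"
proof -
  let ?xs = "sorted_list_of_set B"
  have B: "B = set (take k ?xs) \<union> set (drop k ?xs)"
    using assms by (metis append_take_drop_id set_append set_sorted_list_of_set)
  have "sorted_wrt (<) (take k ?xs @ drop k ?xs)" by simp
  then have lt: "x < y" if "x \<in> set (take k ?xs)" "y \<in> set (drop k ?xs)" for x y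
    using that unfolding sorted_wrt_append by blast
  show "lower_part k B \<subseteq> B" using B by (auto simp: lower_part_def)
  show "card (lower_part k B) = k"
    unfolding lower_part_def using assms by (simp add: distinct_card)
  show "x < y" if "x \<in> lower_part k B" "y \<in> B - lower_part k B" for x y
    using that B lt by (auto simp: lower_part_def)
qed

lemma lower_part_unique:
  assumes "finite B" "D \<subseteq> B" "\<And>x y. x \<in> D \<Longrightarrow> y \<in> B - D \<Longrightarrow> x < y"
  shows "lower_part (card D) B = D"
proof -
  have fin: "finite D" "finite (B - D)" using assms finite_subset by auto
  have "sorted_list_of_set B = sorted_list_of_set D @ sorted_list_of_set (B - D)"
    by (rule sorted_list_of_set_unique[THEN iffD1, OF assms(1)])
      (use assms fin in \<open>auto simp: sorted_wrt_append card_Diff_subset card_mono\<close>)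
  then show ?thesis using fin unfolding lower_part_def by simp
qed

text \<open>The letters \<open>a\<close> and \<open>b\<close> stand in front of the two words. Once
  a letter above \<open>a\<close> is met, \<open>b\<close> must lie below the current and all later
  letters of \<open>q\<close>, so the recursion can stop there.\<close>

fun below_after :: "'a::linorder \<Rightarrow> 'b::linorder \<Rightarrow> 'a list \<Rightarrow> 'b list \<Rightarrow> bool" where
  "below_after a b (c # p) (d # q) =
     (if a < c then \<forall>y\<in>set (d # q). b < y else below_after a b p q)"
| "below_after a b _ _ = True"

fun compatible :: "'a::linorder list \<Rightarrow> 'b::linorder list \<Rightarrow> bool" where
  "compatible (a # p) (b # q) = (compatible p q \<and> below_after a b p q)"
| "compatible _ _ = True"

lemma below_after_iff_nth:
  assumes "length p = length q"
  shows "below_after a b p q \<longleftrightarrow> (\<forall>v<length p. \<forall>w\<le>v. a < p ! w \<longrightarrow> b < q ! v)"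
  using assms
proof (induction p q rule: list_induct2)
  case (Cons c p d q)
  show ?case
  proof (cases "a < c")
    case True
    have "(\<forall>y\<in>set (d # q). b < y) \<longleftrightarrow> (\<forall>v<length (c # p). b < (d # q) ! v)"
      unfolding all_set_conv_all_nth using Cons.hyps by simp
    \<comment> \<open>Since \<open>a < c\<close>, the single position \<open>w = 0\<close> serves
      every \<open>v\<close>.\<close>
    also have "\<dots> \<longleftrightarrow> (\<forall>v<length (c # p). \<forall>w\<le>v. a < (c # p) ! w \<longrightarrow> b < (d # q) ! v)"
      using True by (metis le0 nth_Cons_0)
    finally show ?thesis using True by simp
  next
    case False
    have "(\<forall>v<length (c # p). \<forall>w\<le>v. a < (c # p) ! w \<longrightarrow> b < (d # q) ! v) \<longleftrightarrow>
      (\<forall>v<length p. \<forall>w\<le>v. a < p ! w \<longrightarrow> b < q ! v)"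
      using False unfolding less_Suc_eq_le[symmetric] length_Cons by (simp add: All_less_Suc2)
    then show ?thesis using False Cons.IH by simp
  qed
qed simp

lemma compatible_iff_nth:
  assumes "length p = length q"
  shows "compatible p q \<longleftrightarrow>
    (\<forall>v<length p. \<forall>w\<le>v. \<forall>u<w. p ! u < p ! w \<longrightarrow> q ! u < q ! v)"
  using assms
proof (induction p q rule: list_induct2)
  case (Cons a p b q)
  have "(\<forall>v<length (a # p). \<forall>w\<le>v. \<forall>u<w. (a # p) ! u < (a # p) ! w \<longrightarrow> (b # q) ! u < (b # q) ! v)
    \<longleftrightarrow> (\<forall>v<length p. \<forall>w\<le>v. \<forall>u<w. p ! u < p ! w \<longrightarrow> q ! u < q ! v) \<and>
      (\<forall>v<length p. \<forall>w\<le>v. a < p ! w \<longrightarrow> b < q ! v)"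
    unfolding less_Suc_eq_le[symmetric] length_Cons
    by (simp add: All_less_Suc2 all_conj_distrib imp_conjR) blast
  then show ?case using Cons below_after_iff_nth[OF Cons.hyps] by simp
qed simp

text \<open>The letter \<open>m\<close> triggers the condition at the latest. If an earlier letter
  does, its demand on the whole remainder already includes the second conjunct.\<close>

lemma below_after_append:
  assumes "length p = length q" "a < m"
  shows "below_after a b (p @ m # p') (q @ x # q') \<longleftrightarrow>
    below_after a b p q \<and> (\<forall>y\<in>set (x # q'). b < y)"
  using assms by (induction p q rule: list_induct2) auto

lemma below_after_greatest:
  "\<forall>c\<in>set p. c < m \<Longrightarrow> below_after m b p q"
  by (induction m b p q rule: below_after.induct) auto

text \<open>Each letter before \<open>m\<close> is exceeded by \<open>m\<close>, so its partner lies
  below everything from the cut on, which also settles all its conditions with \<open>p'\<close>.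
  Nothing exceeds \<open>m\<close>, so \<open>x\<close> is unconstrained against
  \<open>q'\<close>.\<close>

lemma compatible_split:
  assumes "length p = length q" "\<forall>a\<in>set p. a < m" "\<forall>a\<in>set p'. a < m"
  shows "compatible (p @ m # p') (q @ x # q') \<longleftrightarrow>
    compatible p q \<and> compatible p' q' \<and> (\<forall>b\<in>set q. \<forall>y\<in>set (x # q'). b < y)"
  using assms
  by (induction p q rule: list_induct2) (auto simp: below_after_append below_after_greatest)

section \<open>Recursion and count for compatible pairs\<close>

definition compatible_pairs :: "'a::linorder set \<Rightarrow> 'b::linorder set \<Rightarrow> ('a list \<times> 'b list) set" where
  "compatible_pairs A B = {(p, q). distinct p \<and> distinct q \<and> set p = A \<and> set q = B \<and> compatible p q}"

text \<open>\<open>S\<close> holds the letters after \<open>m\<close>. By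
  \<open>compatible_split\<close>, the letters of the second word before the cut form an initial
  segment of \<open>B\<close>, and its size forces it to be \<open>L S\<close>; \<open>x\<close> is
  arbitrary in the rest.\<close>

lemma compatible_pairs_split:
  assumes "finite A" "finite B" "card A = card B" "A \<noteq> {}"
  defines "m \<equiv> Max A" and "L \<equiv> (\<lambda>S. lower_part (card A - 1 - card S) B)"
  shows "bij_betw (\<lambda>(S, (p, q), x, p', q'). (p @ m # p', q @ x # q'))
    (SIGMA S : Pow (A - {m}). compatible_pairs (A - {m} - S) (L S) \<times>
       (SIGMA x : B - L S. compatible_pairs S (B - L S - {x})))
    (compatible_pairs A B)" (is "bij_betw ?f ?D _")
proof (rule bij_betw_imageI)
  have m: "m \<in> A" "\<And>a. a \<in> A - {m} \<Longrightarrow> a < m"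
    using assms(1,4) Max_ge[of A] unfolding m_def by (auto simp: less_le)
  have card: "card A = Suc (card (A - {m}))" using card.remove[OF assms(1) m(1)] .
  have fst: "card (A - {m} - S) = card A - 1 - card S" "card A - 1 - card S \<le> card B"
    if "S \<subseteq> A - {m}" for S
    using that assms(1,3) m(1) finite_subset[OF that] by (auto simp: card_Diff_subset)
  have len: "length p = length q"
    if "S \<subseteq> A - {m}" "(p, q) \<in> compatible_pairs (A - {m} - S) (L S)" for S p q
    using that fst[OF that(1)] lower_part(2)[OF assms(2) fst(2)[OF that(1)]]
    by (auto simp: compatible_pairs_def L_def distinct_card[symmetric])
  show "inj_on ?f ?D"
  proof (rule inj_onI)
    fix z z' assume "z \<in> ?D" "z' \<in> ?D" and eq: "?f z = ?f z'"
    then obtain S p q x p' q' T r s y r' s' where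
      z: "z = (S, (p, q), x, p', q')" "S \<subseteq> A - {m}" "(p, q) \<in> compatible_pairs (A - {m} - S) (L S)"
        "(p', q') \<in> compatible_pairs S (B - L S - {x})" and
      z': "z' = (T, (r, s), y, r', s')" "T \<subseteq> A - {m}" "(r, s) \<in> compatible_pairs (A - {m} - T) (L T)"
        "(r', s') \<in> compatible_pairs T (B - L T - {y})"
      by auto
    \<comment> \<open>The first word contains \<open>m\<close> only once and so determines the cut;
      equal lengths transfer it to the second word, and \<open>S\<close> is
      \<open>set p'\<close>.\<close>
    have "m \<notin> set p" "m \<notin> set p'" using z by (auto simp: compatible_pairs_def)
    then have *: "p = r" "p' = r'" using eq z(1) z'(1) append_Cons_eq_iff[of m p p' r r'] by auto
    then have "length q = length s" using len[OF z(2,3)] len[OF z'(2,3)] by simp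
    then have "q = s" "x = y" "q' = s'" using eq z(1) z'(1) by auto
    then show "z = z'" using * z z' by (auto simp: compatible_pairs_def)
  qed
  show "?f ` ?D = compatible_pairs A B"
  proof (intro equalityI subsetI)
    fix c assume "c \<in> ?f ` ?D"
    then obtain S p q x p' q' where z: "c = (p @ m # p', q @ x # q')" "S \<subseteq> A - {m}"
        "(p, q) \<in> compatible_pairs (A - {m} - S) (L S)" "x \<in> B - L S"
        "(p', q') \<in> compatible_pairs S (B - L S - {x})"
      by auto
    have low: "L S \<subseteq> B" "\<And>x y. x \<in> L S \<Longrightarrow> y \<in> B - L S \<Longrightarrow> x < y"
      using lower_part(1,3)[OF assms(2) fst(2)[OF z(2)]] unfolding L_def by blast+
    have "compatible (p @ m # p') (q @ x # q')"
      using z m(2) low(2) by (subst compatible_split[OF len[OF z(2,3)]]) (auto simp: compatible_pairs_def)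
    then show "c \<in> compatible_pairs A B"
      using z m(1) low(1) by (auto simp: compatible_pairs_def)
  next
    fix c assume "c \<in> compatible_pairs A B"
    then obtain p0 q0 where c: "c = (p0, q0)" "distinct p0" "distinct q0" "set p0 = A" "set q0 = B"
      "compatible p0 q0" by (auto simp: compatible_pairs_def)
    then obtain p p' where p: "p0 = p @ m # p'" using m(1) by (metis split_list)
    have "length p0 = length q0" using c assms(3) by (metis distinct_card)
    then have "length p < length q0" using p by simp
    then obtain q x q' where q: "q0 = q @ x # q'" "length p = length q"
      by (metis id_take_nth_drop length_take less_imp_le_nat min.absorb2)
    have comp: "compatible p q" "compatible p' q'" "\<forall>b\<in>set q. \<forall>y\<in>set (x # q'). b < y"
      using compatible_split[OF q(2), of m p' x q'] c p q(1) m(2) by auto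
    have S: "set p' \<subseteq> A - {m}" using c p by auto
    have "card A - 1 - card (set p') = length q"
      using c(2,4) p q(2) distinct_card[OF c(2)] distinct_card[of p'] by simp
    then have "L (set p') = lower_part (card (set q)) B"
      using c(3) q(1) unfolding L_def by (simp add: distinct_card)
    also have "\<dots> = set q"
      using comp(3) c(5) q(1) assms(2) by (intro lower_part_unique) auto
    finally have L: "L (set p') = set q" .
    have "c = ?f (set p', (p, q), x, p', q')" using c(1) p q(1) by simp
    moreover have "(set p', (p, q), x, p', q') \<in> ?D"
      using c p q(1) comp S L by (auto simp: compatible_pairs_def)
    ultimately show "c \<in> ?f ` ?D" by (rule image_eqI)
  qed
qed

text \<open>The recursion is that of the trees: \<open>S\<close> now holds the letters after the
  maximum, and the \<open>Suc (card S)\<close> choices of \<open>x\<close> are the elements of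
  \<open>B - L S\<close>.\<close>

lemma card_compatible_pairs:
  assumes "finite A" "finite B" "card A = card B"
  shows "finite (compatible_pairs A B) \<and> card (compatible_pairs A B) = Suc (card A) ^ (card A - 1)"
  using assms
proof (induction "card A" arbitrary: A B rule: less_induct)
  case less
  show ?case
  proof (cases "A = {}")
    case True
    then have "compatible_pairs A B = {([], [])}" using less.prems by (auto simp: compatible_pairs_def)
    then show ?thesis using True by simp
  next
    case False
    define m where "m = Max A"
    define A' where "A' = A - {m}"
    define L where "L S = lower_part (card A - 1 - card S) B" for S :: "'a set"
    have A': "finite A'" "card A = Suc (card A')" "m \<notin> A'"
      using less.prems(1) card.remove[OF less.prems(1) Max_in[OF less.prems(1) False]]
      unfolding A'_def m_def by auto
    define R where "R S = (SIGMA x : B - L S. compatible_pairs S (B - L S - {x}))" for S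
    let ?D = "SIGMA S : Pow A'. compatible_pairs (A' - S) (L S) \<times> R S"
    have S: "finite S" "card S \<le> card A'" "finite (L S)" "card (L S) = card A' - card S"
      "card (B - L S) = Suc (card S)" if "S \<subseteq> A'" for S
    proof -
      show *: "finite S" "card S \<le> card A'" using that A'(1) finite_subset card_mono by auto
      have "card A - 1 - card S \<le> card B" using less.prems(3) by simp
      note low = lower_part(1,2)[OF less.prems(2) this, folded L_def]
      show fin: "finite (L S)" using low(1) less.prems(2) finite_subset by blast
      show "card (L S) = card A' - card S" using low(2) A'(2) by simp
      then show "card (B - L S) = Suc (card S)"
        using card_Diff_subset[OF fin low(1)] * A'(2) less.prems(3) by simp
    qed
    have left: "finite (compatible_pairs (A' - S) (L S))"
      "card (compatible_pairs (A' - S) (L S)) = Suc (card A' - card S) ^ (card A' - card S - 1)"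
      if "S \<subseteq> A'" for S
      using less.hyps[of "A' - S" "L S"] that A' S[OF that] by (auto simp: card_Diff_subset)
    have right: "finite (R S)" "card (R S) = Suc (card S) ^ card S"
      if "S \<subseteq> A'" for S
    proof -
      have *: "finite (compatible_pairs S (B - L S - {x})) \<and>
        card (compatible_pairs S (B - L S - {x})) = Suc (card S) ^ (card S - 1)"
        if "x \<in> B - L S" for x
        using less.hyps[of S "B - L S - {x}"] that S[OF \<open>S \<subseteq> A'\<close>] A'(2) less.prems(2)
        by (simp add: card_Diff_singleton)
      then show "finite (R S)" using less.prems(2) unfolding R_def by blast
      show "card (R S) = Suc (card S) ^ card S"
        unfolding R_def using * S[OF that] less.prems(2) by (cases "card S") auto
    qed
    note split = compatible_pairs_split[OF less.prems False, folded m_def, folded A'_def L_def R_def]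
    have fin: "finite ?D"
      using left right A'(1) by (intro finite_SigmaI finite_cartesian_product) simp_all
    have "card ?D = (\<Sum>S\<in>Pow A'. card (compatible_pairs (A' - S) (L S)) * card (R S))"
      using left right A'(1) by (subst card_SigmaI) (simp_all add: card_cartesian_product)
    also have "\<dots> = (\<Sum>S\<in>Pow A'. Suc (card S) ^ card S * Suc (card A' - card S) ^ (card A' - card S - 1))"
      by (intro sum.cong refl) (simp add: left right)
    also have "\<dots> = Suc (card A) ^ card A'" using sum_Pow_abel[OF A'(1)] A'(2) by simp
    finally have card: "card ?D = Suc (card A) ^ card A'" .
    have "card (compatible_pairs A B) = Suc (card A) ^ card A'"
      using card unfolding bij_betw_same_card[OF split] .
    moreover have "finite (compatible_pairs A B)"
      using fin unfolding bij_betw_finite[OF split] .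
    ultimately show ?thesis using A'(2) by simp
  qed
qed

section \<open>Pairs of standardized columns\<close>

definition admissible :: "nat \<Rightarrow> (nat \<Rightarrow> nat) \<Rightarrow> (nat \<Rightarrow> nat) \<Rightarrow> bool" where
  "admissible n \<pi> \<sigma> \<longleftrightarrow> \<pi> permutes {1..n} \<and> \<sigma> permutes {1..n} \<and>
    (\<forall>i\<in>{1..n}. \<forall>r\<in>{1..n}. \<forall>j\<in>{1..n}. i < r \<longrightarrow> \<sigma> i < \<sigma> r \<longrightarrow> \<sigma> r \<le> \<sigma> j \<longrightarrow> \<pi> i < \<pi> j)"

lemma standardization_props:
  assumes "inj_on w {1..n}"
  shows "standardization n w permutes {1..n}"
    "\<And>i k. i \<in> {1..n} \<Longrightarrow> k \<in> {1..n} \<Longrightarrow> standardization n w i < standardization n w k \<longleftrightarrow> w i < w k"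
  using theI'[OF ex1_standardization[OF assms]] unfolding standardization_def by blast+

lemma standardization_eqI:
  assumes "\<pi> permutes {1..n}"
    and "\<And>i k. i \<in> {1..n} \<Longrightarrow> k \<in> {1..n} \<Longrightarrow> w i < w k \<longleftrightarrow> \<pi> i < \<pi> k"
  shows "standardization n w = \<pi>"
proof -
  have "inj_on w {1..n}"
    using assms permutes_inj_on[OF assms(1)]
    by (metis inj_on_def less_irrefl linorder_neqE_nat)
  from the1_equality[OF ex1_standardization[OF this]] assms show ?thesis
    unfolding standardization_def by auto
qed

text \<open>The contrapositive of the triple condition, together with the decrease in row
  \<open>j\<close>, gives the chain \<open>\<tau> (i, 1) < \<tau> (r, 2) \<le> \<tau> (j, 2) <
  \<tau> (j, 1)\<close>.\<close>

lemma st_pairs_admissible: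
  assumes "\<tau> \<in> SPCT2 n"
  shows "admissible n (col_st n 1 \<tau>) (col_st n 2 \<tau>)"
proof -
  have inj: "inj_on \<tau> ({1..n} \<times> {1..2})"
    and row: "\<And>i. i \<in> {1..n} \<Longrightarrow> \<tau> (i, 1) > \<tau> (i, 2)"
    and triple: "\<And>i r. i \<in> {1..n} \<Longrightarrow> r \<in> {1..n} \<Longrightarrow> i < r \<Longrightarrow> \<tau> (i, 1) \<ge> \<tau> (r, 2) \<Longrightarrow> \<tau> (i, 2) > \<tau> (r, 2)"
    using assms by (auto simp: SPCT2_def bij_betw_def)
  have "inj_on (\<lambda>i. \<tau> (i, j)) {1..n}" if "j \<in> {1..2}" for j
    using that by (auto intro!: inj_onI dest: inj_onD[OF inj])
  then have st: "inj_on (\<lambda>i. \<tau> (i, 1)) {1..n}" "inj_on (\<lambda>i. \<tau> (i, 2)) {1..n}" by auto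
  note st1 = standardization_props[OF st(1)] and st2 = standardization_props[OF st(2)]
  show ?thesis
    unfolding admissible_def col_st_def
  proof (intro conjI ballI impI st1(1) st2(1))
    fix i r j
    assume ir: "i \<in> {1..n}" "r \<in> {1..n}" "j \<in> {1..n}" "i < r"
    assume "standardization n (\<lambda>i. \<tau> (i, 2)) i < standardization n (\<lambda>i. \<tau> (i, 2)) r"
      "standardization n (\<lambda>i. \<tau> (i, 2)) r \<le> standardization n (\<lambda>i. \<tau> (i, 2)) j"
    then have "\<tau> (i, 2) < \<tau> (r, 2)" "\<tau> (r, 2) \<le> \<tau> (j, 2)"
      using st2(2) ir by (simp_all flip: not_less)
    then have "\<tau> (i, 1) < \<tau> (j, 1)"
      using triple[OF ir(1,2,4)] row[OF ir(3)] by linarith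
    then show "standardization n (\<lambda>i. \<tau> (i, 1)) i < standardization n (\<lambda>i. \<tau> (i, 1)) j"
      using st1(2) ir by simp
  qed
qed

text \<open>The columns are merged by placing each first-column entry as early as possible, i.e. right
  after the largest second-column entry that has to precede it: \<open>M i\<close> second-column entries come
  before the first entry of row \<open>i\<close>, and \<open>N i\<close> first-column entries before its second one.\<close>

lemma admissible_st_pairs:
  assumes "admissible n \<pi> \<sigma>"
  shows "\<exists>\<tau>\<in>SPCT2 n. \<pi> = col_st n 1 \<tau> \<and> \<sigma> = col_st n 2 \<tau>"
proof -
  have pi: "\<pi> permutes {1..n}" and sigma: "\<sigma> permutes {1..n}"
    and adm: "\<And>i r j. i \<in> {1..n} \<Longrightarrow> r \<in> {1..n} \<Longrightarrow> j \<in> {1..n} \<Longrightarrow> i < r \<Longrightarrow>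
      \<sigma> i < \<sigma> r \<Longrightarrow> \<sigma> r \<le> \<sigma> j \<Longrightarrow> \<pi> i < \<pi> j"
    using assms unfolding admissible_def by blast+
  have rng: "\<pi> i \<in> {1..n}" "\<sigma> i \<in> {1..n}" if "i \<in> {1..n}" for i
    using that permutes_in_image[OF pi] permutes_in_image[OF sigma] by auto
  have card_below: "card {j\<in>{1..n}. \<pi> j < k} = k - 1" if "k \<le> Suc n" for k
  proof -
    have "\<pi> ` {j\<in>{1..n}. \<pi> j < k} = {i\<in>\<pi> ` {1..n}. i < k}" by blast
    also have "\<dots> = {1..<k}" using permutes_image[OF pi] that by auto
    finally show ?thesis using card_image[OF permutes_inj_on[OF pi]] by (metis card_atLeastLessThan)
  qed
  \<comment> \<open>The second entry of row \<open>j\<close> precedes the first entry of row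
    \<open>j\<close>, hence also that of row \<open>i\<close> if
    \<open>\<pi> j \<le> \<pi> i\<close>.\<close>
  define M where "M i = Max (\<sigma> ` {j\<in>{1..n}. \<pi> j \<le> \<pi> i})" for i
  define N where "N i = card {j\<in>{1..n}. M j < \<sigma> i}" for i
  \<comment> \<open>An entry is its position in the merged order: its rank within its column plus
    the number of entries of the other column before it.\<close>
  define \<tau> :: "nat \<times> nat \<Rightarrow> nat" where "\<tau> = restrict (\<lambda>(i, k). if k = 1 then \<pi> i + M i else \<sigma> i + N i) ({1..n} \<times> {1..2})"
  have \<tau>: "\<tau> (i, 1) = \<pi> i + M i" "\<tau> (i, 2) = \<sigma> i + N i" if "i \<in> {1..n}" for i
    using that by (auto simp: \<tau>_def)
  have M_less: "M i < k \<longleftrightarrow> (\<forall>j\<in>{1..n}. \<pi> j \<le> \<pi> i \<longrightarrow> \<sigma> j < k)" if "i \<in> {1..n}" for i k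
    unfolding M_def using that by (subst Max_less_iff) auto
  have M_mono: "M i \<le> M j" if "i \<in> {1..n}" "j \<in> {1..n}" "\<pi> i \<le> \<pi> j" for i j
    unfolding M_def using that by (intro Max_mono) auto
  have M_ge: "\<sigma> i \<le> M i" if "i \<in> {1..n}" for i
    using M_less[OF that, of "\<sigma> i"] that by (meson not_less order_refl)
  have M_le: "M i \<le> n" if "i \<in> {1..n}" for i
    using M_less[OF that, of "Suc n"] rng(2) by (simp add: less_Suc_eq_le)
  have N_mono: "N i \<le> N j" if "\<sigma> i \<le> \<sigma> j" for i j
    unfolding N_def using that by (intro card_mono) auto
  have N_le: "N i \<le> n" for i
  proof -
    have "N i \<le> card {1..n}" unfolding N_def by (intro card_mono) auto
    then show ?thesis by simp
  qed
  have less1: "\<tau> (i, 1) < \<tau> (j, 1) \<longleftrightarrow> \<pi> i < \<pi> j" if "i \<in> {1..n}" "j \<in> {1..n}" for i j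
    using that M_mono[of i j] M_mono[of j i]
    unfolding \<tau>(1)[OF that(1)] \<tau>(1)[OF that(2)] by (cases "\<pi> i < \<pi> j") auto
  have less2: "\<tau> (i, 2) < \<tau> (j, 2) \<longleftrightarrow> \<sigma> i < \<sigma> j" if "i \<in> {1..n}" "j \<in> {1..n}" for i j
    using that N_mono[of i j] N_mono[of j i]
    unfolding \<tau>(2)[OF that(1)] \<tau>(2)[OF that(2)] by (cases "\<sigma> i < \<sigma> j") auto
  \<comment> \<open>All \<open>\<pi> i\<close> rows whose first entry has rank at most
    \<open>\<pi> i\<close> are counted by \<open>N j\<close>, so
    \<open>\<pi> i \<le> N j\<close>.\<close>
  have less12: "\<tau> (i, 1) < \<tau> (j, 2)" if "i \<in> {1..n}" "j \<in> {1..n}" "M i < \<sigma> j" for i j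
  proof -
    have "M k < \<sigma> j" if "k \<in> {1..n}" "\<pi> k < Suc (\<pi> i)" for k
      using M_mono[OF that(1) \<open>i \<in> {1..n}\<close>] that(2) \<open>M i < \<sigma> j\<close> by linarith
    then have "{k\<in>{1..n}. \<pi> k < Suc (\<pi> i)} \<subseteq> {k\<in>{1..n}. M k < \<sigma> j}" by blast
    then have "card {k\<in>{1..n}. \<pi> k < Suc (\<pi> i)} \<le> N j" unfolding N_def by (intro card_mono) auto
    moreover have "card {k\<in>{1..n}. \<pi> k < Suc (\<pi> i)} = \<pi> i" using card_below rng[OF that(1)] by simp
    ultimately show ?thesis
      using that(3) unfolding \<tau>(1)[OF that(1)] \<tau>(2)[OF that(2)] by simp
  qed
  \<comment> \<open>Only rows of first-column rank below \<open>\<pi> i\<close> are counted by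
    \<open>N j\<close>, so \<open>N j \<le> \<pi> i - 1\<close>; strictness comes from
    \<open>\<pi> i \<ge> 1\<close>.\<close>
  have less21: "\<tau> (j, 2) < \<tau> (i, 1)" if "i \<in> {1..n}" "j \<in> {1..n}" "\<sigma> j \<le> M i" for i j
  proof -
    have "\<pi> k < \<pi> i" if "k \<in> {1..n}" "M k < \<sigma> j" for k
      using M_mono[OF \<open>i \<in> {1..n}\<close> that(1)] that(2) \<open>\<sigma> j \<le> M i\<close> by linarith
    then have "{k\<in>{1..n}. M k < \<sigma> j} \<subseteq> {k\<in>{1..n}. \<pi> k < \<pi> i}" by blast
    then have "N j \<le> card {k\<in>{1..n}. \<pi> k < \<pi> i}" unfolding N_def by (intro card_mono) auto
    moreover have "card {k\<in>{1..n}. \<pi> k < \<pi> i} = \<pi> i - 1" using card_below rng[OF that(1)] by simp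
    ultimately show ?thesis
      using that(3) rng(1)[OF that(1)]
      unfolding \<tau>(1)[OF that(1)] \<tau>(2)[OF that(2)] atLeastAtMost_iff by linarith
  qed
  have neq12: "\<tau> (i, 1) \<noteq> \<tau> (j, 2)" if "i \<in> {1..n}" "j \<in> {1..n}" for i j
    using less12[OF that] less21[OF that] by (metis less_irrefl not_less)
  have eq1: "i = j" if "i \<in> {1..n}" "j \<in> {1..n}" "\<tau> (i, 1) = \<tau> (j, 1)" for i j
    using less1[OF that(1,2)] less1[OF that(2,1)] that(3) permutes_inj[OF pi]
    by (metis injD less_irrefl linorder_neqE_nat)
  have eq2: "i = j" if "i \<in> {1..n}" "j \<in> {1..n}" "\<tau> (i, 2) = \<tau> (j, 2)" for i j
    using less2[OF that(1,2)] less2[OF that(2,1)] that(3) permutes_inj[OF sigma]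
    by (metis injD less_irrefl linorder_neqE_nat)
  have two: "{1..2} = {1, 2::nat}" by auto
  have "inj_on \<tau> ({1..n} \<times> {1..2})"
  proof (rule inj_onI)
    fix x y assume xy: "x \<in> {1..n} \<times> {1..2::nat}" "y \<in> {1..n} \<times> {1..2::nat}" "\<tau> x = \<tau> y"
    then obtain i k j l where "x = (i, k)" "y = (j, l)" "i \<in> {1..n}" "j \<in> {1..n}"
      "k = 1 \<or> k = 2" "l = 1 \<or> l = 2" unfolding two by blast
    then show "x = y"
      using xy(3) eq1[of i j] eq2[of i j] neq12[of i j] neq12[of j i] by metis
  qed
  moreover have "\<tau> ` ({1..n} \<times> {1..2}) \<subseteq> {1..2 * n}"
  proof
    fix y assume "y \<in> \<tau> ` ({1..n} \<times> {1..2})"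
    then obtain i where i: "i \<in> {1..n}" "y = \<pi> i + M i \<or> y = \<sigma> i + N i"
      unfolding two using \<tau> by auto
    then show "y \<in> {1..2 * n}" using rng[OF i(1)] M_le[OF i(1)] N_le[of i] by auto
  qed
  \<comment> \<open>An injection between sets of the same size \<open>2 * n\<close> is onto.\<close>
  ultimately have "bij_betw \<tau> ({1..n} \<times> {1..2}) {1..2 * n}"
    unfolding bij_betw_def
    by (intro conjI card_subset_eq) (auto simp: card_image card_cartesian_product)
  moreover have "\<tau> (i, 1) > \<tau> (i, 2)" if "i \<in> {1..n}" for i
    using less21[OF that that] M_ge[OF that] by simp
  moreover have "\<tau> (i, 2) > \<tau> (r, 2)" if "i \<in> {1..n}" "r \<in> {1..n}" "i < r" "\<tau> (i, 1) \<ge> \<tau> (r, 2)" for i r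
  proof (rule ccontr)
    assume "\<not> \<tau> (i, 2) > \<tau> (r, 2)"
    then have "\<sigma> i < \<sigma> r"
      using less2[OF that(2,1)] that(3) permutes_inj[OF sigma] by (metis injD less_irrefl linorder_neqE_nat)
    \<comment> \<open>A row \<open>j\<close> with \<open>\<pi> j \<le> \<pi> i\<close> and
      \<open>\<sigma> r \<le> \<sigma> j\<close> would contradict admissibility.\<close>
    then have "M i < \<sigma> r"
      unfolding M_less[OF that(1)] using adm[OF that(1,2) _ that(3)] by (meson not_le)
    then show False using less12[OF that(1,2)] that(4) by simp
  qed
  ultimately have "\<tau> \<in> SPCT2 n"
    unfolding SPCT2_def by (auto simp: \<tau>_def)
  moreover have "\<pi> = col_st n 1 \<tau>"
    unfolding col_st_def by (rule standardization_eqI[symmetric, OF pi less1])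
  moreover have "\<sigma> = col_st n 2 \<tau>"
    unfolding col_st_def by (rule standardization_eqI[symmetric, OF sigma less2])
  ultimately show ?thesis by blast
qed

lemma st_pairs_eq: "st_pairs n = {(\<pi>, \<sigma>). admissible n \<pi> \<sigma>}"
proof (intro equalityI subsetI)
  fix x assume "x \<in> st_pairs n"
  then show "x \<in> {(\<pi>, \<sigma>). admissible n \<pi> \<sigma>}"
    unfolding st_pairs_def using st_pairs_admissible by auto
next
  fix x assume "x \<in> {(\<pi>, \<sigma>). admissible n \<pi> \<sigma>}"
  then show "x \<in> st_pairs n"
    unfolding st_pairs_def using admissible_st_pairs by force
qed

section \<open>Permutations as words\<close>

definition word :: "nat \<Rightarrow> (nat \<Rightarrow> nat) \<Rightarrow> nat list" where
  "word n f = map f [1..<Suc n]"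

lemma length_word: "length (word n f) = n"
  by (simp add: word_def)

lemma nth_word: "i < n \<Longrightarrow> word n f ! i = f (Suc i)"
  by (simp add: word_def del: upt_Suc)

lemma set_word: "set (word n f) = f ` {1..n}"
  by (simp add: word_def atLeastLessThanSuc_atLeastAtMost del: upt_Suc)

lemma distinct_set_word:
  assumes "f permutes {1..n}"
  shows "distinct (word n f)" "set (word n f) = {1..n}"
  using permutes_inj_on[OF assms] permutes_image[OF assms]
  by (simp_all add: set_word)
    (simp add: word_def distinct_map atLeastLessThanSuc_atLeastAtMost del: upt_Suc)

lemma word_eq_iff:
  assumes "f permutes {1..n}" "g permutes {1..n}"
  shows "word n f = word n g \<longleftrightarrow> f = g"
proof
  assume "word n f = word n g"
  then have "f i = g i" if "i \<in> {1..n}" for i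
    using that nth_word[of "i - 1" n f] nth_word[of "i - 1" n g] by auto
  then show "f = g" using assms by (metis ext permutes_not_in)
qed simp

lemma word_surj:
  assumes "distinct p" "set p = {1..n}"
  obtains f where "f permutes {1..n}" "word n f = p"
proof
  \<comment> \<open>List positions start at 0, hence \<open>i - 1\<close>; outside the range
    \<open>f\<close> is the identity, as \<open>permutes\<close> demands.\<close>
  define f where "f i = (if i \<in> {1..n} then p ! (i - 1) else i)" for i
  have len: "length p = n" using assms by (metis card_atLeastAtMost diff_Suc_1 distinct_card)
  show word: "word n f = p"
    by (rule nth_equalityI) (auto simp: length_word len nth_word f_def)
  have "f ` {1..n} = {1..n}"
    using set_word[of n f] unfolding word assms(2) ..
  moreover from this have "inj_on f {1..n}" by (intro eq_card_imp_inj_on) (simp_all only: finite_atLeastAtMost)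
  ultimately show "f permutes {1..n}"
    by (intro bij_imp_permutes) (auto simp: bij_betw_def f_def)
qed

text \<open>\<open>\<rho>\<close> lists the rows by increasing second entry. Substituting
  \<open>i = \<rho> (Suc u)\<close> turns comparisons of second entries into comparisons of
  positions, and comparisons of rows into comparisons of letters.\<close>

lemma admissible_iff_compatible:
  assumes "\<rho> permutes {1..n}" "\<kappa> permutes {1..n}"
  shows "admissible n (\<kappa> \<circ> inv \<rho>) (inv \<rho>) \<longleftrightarrow> compatible (word n \<rho>) (word n \<kappa>)"
proof -
  have inv: "inv \<rho> permutes {1..n}" and comp: "\<kappa> \<circ> inv \<rho> permutes {1..n}"
    using assms by (simp_all add: permutes_inv permutes_compose)
  have inv_rho: "inv \<rho> (\<rho> i) = i" for i using permutes_inverses(2)[OF assms(1)] .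
  have ball: "(\<forall>i\<in>{1..n}. P i) \<longleftrightarrow> (\<forall>u<n. P (\<rho> (Suc u)))" for P
  proof -
    have "(\<forall>i\<in>{1..n}. P i) \<longleftrightarrow> (\<forall>i\<in>\<rho> ` {1..n}. P i)" using permutes_image[OF assms(1)] by simp
    also have "\<dots> \<longleftrightarrow> (\<forall>u<n. P (\<rho> (Suc u)))"
      unfolding image_Suc_lessThan[symmetric] by auto
    finally show ?thesis .
  qed
  have "admissible n (\<kappa> \<circ> inv \<rho>) (inv \<rho>) \<longleftrightarrow>
    (\<forall>u<n. \<forall>w<n. \<forall>v<n. \<rho> (Suc u) < \<rho> (Suc w) \<longrightarrow> u < w \<longrightarrow> w \<le> v \<longrightarrow> \<kappa> (Suc u) < \<kappa> (Suc v))"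
    unfolding admissible_def ball using inv comp by (simp add: inv_rho)
  also have "\<dots> \<longleftrightarrow> compatible (word n \<rho>) (word n \<kappa>)"
    by (subst compatible_iff_nth)
      (auto simp: length_word nth_word, metis order_le_less_trans order_less_trans)
  finally show ?thesis .
qed

text \<open>The first word determines \<open>\<sigma>\<close>; composing the permutation of the
  second word with \<open>\<sigma>\<close> then returns \<open>\<pi>\<close>.\<close>

lemma bij_betw_st_pairs:
  "bij_betw (\<lambda>(\<pi>, \<sigma>). (word n (inv \<sigma>), word n (\<pi> \<circ> inv \<sigma>))) (st_pairs n) (compatible_pairs {1..n} {1..n})"
  (is "bij_betw ?f _ _")
proof (rule bij_betw_imageI)
  have perm: "\<pi> permutes {1..n}" "\<sigma> permutes {1..n}" "inv \<sigma> permutes {1..n}"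
    "\<pi> \<circ> inv \<sigma> permutes {1..n}" "\<pi> \<circ> inv \<sigma> \<circ> inv (inv \<sigma>) = \<pi>" "inv (inv \<sigma>) = \<sigma>"
    if "admissible n \<pi> \<sigma>" for \<pi> \<sigma>
    using that by (auto simp: admissible_def permutes_inv permutes_compose permutes_inv_inv
        comp_assoc permutes_inv_o)
  show "inj_on ?f (st_pairs n)"
  proof (rule inj_onI)
    fix x y assume "x \<in> st_pairs n" "y \<in> st_pairs n" and eq: "?f x = ?f y"
    then obtain \<pi> \<sigma> \<pi>' \<sigma>' where xy: "x = (\<pi>, \<sigma>)" "admissible n \<pi> \<sigma>" "y = (\<pi>', \<sigma>')" "admissible n \<pi>' \<sigma>'"
      unfolding st_pairs_eq by auto
    then have "inv \<sigma> = inv \<sigma>'" "\<pi> \<circ> inv \<sigma> = \<pi>' \<circ> inv \<sigma>'"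
      using eq word_eq_iff[OF perm(3)[OF xy(2)] perm(3)[OF xy(4)]]
        word_eq_iff[OF perm(4)[OF xy(2)] perm(4)[OF xy(4)]] by auto
    then show "x = y" using xy perm(5,6) by metis
  qed
  show "?f ` st_pairs n = compatible_pairs {1..n} {1..n}"
  proof (intro equalityI subsetI)
    fix c assume "c \<in> ?f ` st_pairs n"
    then obtain \<pi> \<sigma> where c: "c = ?f (\<pi>, \<sigma>)" and adm: "admissible n \<pi> \<sigma>"
      unfolding st_pairs_eq by auto
    have "compatible (word n (inv \<sigma>)) (word n (\<pi> \<circ> inv \<sigma>))"
      using admissible_iff_compatible[OF perm(3,4)[OF adm]] adm perm(5,6)[OF adm] by simp
    then show "c \<in> compatible_pairs {1..n} {1..n}"
      using c distinct_set_word[OF perm(3)[OF adm]] distinct_set_word[OF perm(4)[OF adm]]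
      by (simp add: compatible_pairs_def)
  next
    fix c assume "c \<in> compatible_pairs {1..n} {1..n}"
    then obtain p q where c: "c = (p, q)" "distinct p" "set p = {1..n}" "distinct q" "set q = {1..n}"
      "compatible p q" by (auto simp: compatible_pairs_def)
    obtain \<rho> \<kappa> where w: "\<rho> permutes {1..n}" "word n \<rho> = p" "\<kappa> permutes {1..n}" "word n \<kappa> = q"
      using word_surj[OF c(2,3)] word_surj[OF c(4,5)] by metis
    have "(\<kappa> \<circ> inv \<rho>, inv \<rho>) \<in> st_pairs n"
      unfolding st_pairs_eq using admissible_iff_compatible[OF w(1,3)] w c(6) by simp
    moreover have "?f (\<kappa> \<circ> inv \<rho>, inv \<rho>) = c"
      using c(1) w by (simp add: permutes_inv_inv[OF w(1)] comp_assoc permutes_inv_o[OF w(1)])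
    ultimately show "c \<in> ?f ` st_pairs n" by force
  qed
qed

section \<open>Comparison of the two counts\<close>

lemma labeled_trees_without_right_ascents:
  "{t \<in> labeled_binary_trees n. right_ascents t = {}} = decreasing_trees {1..n}"
proof -
  have "size t = n" if "set_tree t = {1..n}" "distinct (inorder t)" for t
    using distinct_card[OF that(2)] that(1) by simp
  then show ?thesis by (auto simp: labeled_binary_trees_def decreasing_trees_def)
qed

theorem theorem4p9:
  fixes n :: nat
  assumes "n \<ge> 1"
  shows "st_pairs n \<subseteq> {\<pi>. \<pi> permutes {1..n}} \<times> {\<pi>. \<pi> permutes {1..n}} \<and>
    (\<exists>f. bij_betw f (st_pairs n) {t \<in> labeled_binary_trees n. right_ascents t = {}}) \<and>
    card (st_pairs n) = (n + 1) ^ (n - 1)"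
proof (intro conjI)
  let ?T = "{t \<in> labeled_binary_trees n. right_ascents t = {}}"
  show "st_pairs n \<subseteq> {\<pi>. \<pi> permutes {1..n}} \<times> {\<pi>. \<pi> permutes {1..n}}"
    by (auto simp: st_pairs_eq admissible_def)
  have pairs: "finite (st_pairs n)" "card (st_pairs n) = Suc n ^ (n - 1)"
    using card_compatible_pairs[of "{1..n}" "{1..n}"] bij_betw_finite[OF bij_betw_st_pairs]
      bij_betw_same_card[OF bij_betw_st_pairs, of n] by simp_all
  then show "card (st_pairs n) = (n + 1) ^ (n - 1)" by simp
  have "finite ?T" "card ?T = Suc n ^ (n - 1)"
    using card_decreasing_trees[of "{1..n}"] unfolding labeled_trees_without_right_ascents by simp_all
  \<comment> \<open>The bijection is not constructed: two finite sets of equal cardinality are in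
    bijection.\<close>
  then show "\<exists>f. bij_betw f (st_pairs n) ?T"
    using pairs by (intro finite_same_card_bij) simp_all
qed

end
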